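(* Let $D\ge 1$ and $N>2D$ be integers, let $q$ be a prime power, let $\Gamma=J_q(N,D)$ with adjacency matrix $A$, and let $x$ be a vertex of $\Gamma$. For every subspace $\alpha\subseteq x$, with $i=\dim\alpha$, $$A\alpha^{\vee}=\theta_i\,\alpha^{\vee}+[D-i+1]\sum_{\alpha\text{ covers }\beta}\beta^{\vee}.$$
   Context: Let $\mathbb{F}_q$ be a finite field with $q$ elements and $\mathcal{V}$ an $N$-dimensional vector space over $\mathbb{F}_q$. The Grassmann graph $\Gamma=J_q(N,D)$ has vertex set $X$ consisting of the $D$-dimensional subspaces of $\mathcal{V}$; $y,z\in X$ are adjacent iff $\dim(y\cap z)=D-1$. $[\ell]=\frac{q^\ell-1}{q-1}$ for integers $\ell$. The eigenvalues of $\Gamma$ are $\theta_i=q[D][N-D]-[i][N-i+1]$ for $0\le i\le D$. For subspaces $u,v$ of $\mathcal{V}$, $v$ covers $u$ means $u\subseteq v$ and $\dim v=\dim u+1$. Let $V=\mathbb{C}^X$ (column vectors), and for $y\in X$ let $\widehat y\in V$ have $1$ in coordinate $y$ and $0$ elsewhere. For a subspace $\alpha\subseteq x$, $\alpha^{\vee}=\sum_{y\in X,\ \alpha\subseteq y}\widehat y$. The sum in the claim runs over all subspaces $\beta$ covered by $\alpha$. *)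

theory Defs
  imports Complex_Main "HOL-Library.Cardinality"
begin

text \<open>Vectors of \<open>\<complex>\<^sup>X\<close> and matrices indexed by \<open>X \<times> X\<close> are total functions that vanish
  outside the index set, so that equality of functions is equality of vectors.\<close>

definition mat_vec_mult :: "'v set \<Rightarrow> ('v \<Rightarrow> 'v \<Rightarrow> complex) \<Rightarrow> ('v \<Rightarrow> complex) \<Rightarrow> 'v \<Rightarrow> complex" where
  "mat_vec_mult X M f = (\<lambda>y. \<Sum>z\<in>X. M y z * f z)"

definition unit_vec :: "'v \<Rightarrow> 'v \<Rightarrow> complex" where
  "unit_vec y = (\<lambda>z. if z = y then 1 else 0)"

definition q_int :: "nat \<Rightarrow> int \<Rightarrow> complex" where
  "q_int q l = (of_nat q powi l - 1) / (of_nat q - 1)"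

definition grassmann_eigenvalue :: "nat \<Rightarrow> nat \<Rightarrow> nat \<Rightarrow> nat \<Rightarrow> complex" where
  "grassmann_eigenvalue q N D i =
     of_nat q * q_int q (int D) * q_int q (int N - int D)
       - q_int q (int i) * q_int q (int N - int i + 1)"

text \<open>The ambient space is finite-dimensional wherever the following notions are used, so
  \<open>vector_space.dim\<close> never takes its default value \<open>0\<close> for infinite-dimensional subspaces.\<close>

definition grassmann_verts :: "('a::field \<Rightarrow> 'v::ab_group_add \<Rightarrow> 'v) \<Rightarrow> nat \<Rightarrow> 'v set set" where
  "grassmann_verts scale D = {y. module.subspace scale y \<and> vector_space.dim scale y = D}"

definition grassmann_adj ::
  "('a::field \<Rightarrow> 'v::ab_group_add \<Rightarrow> 'v) \<Rightarrow> nat \<Rightarrow> 'v set \<Rightarrow> 'v set \<Rightarrow> bool" where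
  "grassmann_adj scale D y z \<longleftrightarrow>
     y \<in> grassmann_verts scale D \<and> z \<in> grassmann_verts scale D \<and>
     int (vector_space.dim scale (y \<inter> z)) = int D - 1"

definition grassmann_matrix ::
  "('a::field \<Rightarrow> 'v::ab_group_add \<Rightarrow> 'v) \<Rightarrow> nat \<Rightarrow> 'v set \<Rightarrow> 'v set \<Rightarrow> complex" where
  "grassmann_matrix scale D y z = (if grassmann_adj scale D y z then 1 else 0)"

definition covers :: "('a::field \<Rightarrow> 'v::ab_group_add \<Rightarrow> 'v) \<Rightarrow> 'v set \<Rightarrow> 'v set \<Rightarrow> bool" where
  "covers scale v u \<longleftrightarrow>
     module.subspace scale v \<and> module.subspace scale u \<and> u \<subseteq> v \<and>
     vector_space.dim scale v = vector_space.dim scale u + 1"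

definition vee ::
  "('a::field \<Rightarrow> 'v::ab_group_add \<Rightarrow> 'v) \<Rightarrow> nat \<Rightarrow> 'v set \<Rightarrow> 'v set \<Rightarrow> complex" where
  "vee scale D \<alpha> = (\<lambda>z. \<Sum>y | y \<in> grassmann_verts scale D \<and> \<alpha> \<subseteq> y. unit_vec y z)"

end

theory Submission
  imports Defs
begin

text \<open>The \<open>y\<close>-entry of \<open>A \<alpha>\<^sup>\<or>\<close> is the number of neighbours of \<open>y\<close> that contain \<open>\<alpha>\<close>. It is
  \<open>[D - i] ([N - D + 1] - 1)\<close> if \<open>\<alpha> \<subseteq> y\<close>, it is \<open>[D - i + 1]\<close> if \<open>\<alpha> \<inter> y\<close> is a hyperplane of \<open>\<alpha>\<close>, and
  it is \<open>0\<close> otherwise. The sum over \<open>\<beta>\<close> has \<open>y\<close>-entry \<open>[i]\<close>, \<open>1\<close> and \<open>0\<close> in these three cases.\<close>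

section \<open>Arithmetic of the \<open>q\<close>-integers\<close>

lemma q_int_nat: "q_int q (int n) = (of_nat q ^ n - 1) / (of_nat q - 1)"
  by (simp add: q_int_def)

lemma q_int_0 [simp]: "q_int q 0 = 0"
  by (simp add: q_int_def)

lemma q_int_1 [simp]: "q \<noteq> 1 \<Longrightarrow> q_int q 1 = 1"
  by (simp add: q_int_def)

text \<open>The third hypothesis is the form that a double count takes: \<open>c\<close> covers of a
  \<open>d\<close>-dimensional subspace share out the vectors of an \<open>m\<close>-dimensional
  space outside that subspace. Cancelling q^d (q - 1), nonzero because \<open>q \<ge> 2\<close>,
  leaves [m - d].\<close>

lemma q_int_eqI:
  assumes "q \<ge> 2" "d \<le> m"
    and "of_nat c * (of_nat q ^ Suc d - of_nat q ^ d) = (of_nat q ^ m - of_nat q ^ d :: complex)"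
  shows "of_nat c = q_int q (int m - int d)"
proof -
  have q: "of_nat q \<noteq> (0 :: complex)" "of_nat q - 1 \<noteq> (0 :: complex)"
    using assms(1) of_nat_eq_1_iff[of q, where ?'a = complex] by auto
  obtain k where k: "m = d + k"
    using assms(2) le_Suc_ex by blast
  have "of_nat q ^ d * (of_nat c * (of_nat q - 1)) = of_nat q ^ d * (of_nat q ^ k - 1 :: complex)"
    using assms(3) by (simp add: k power_add algebra_simps)
  then have "of_nat c * (of_nat q - 1) = (of_nat q ^ k - 1 :: complex)"
    using q(1) by simp
  then show ?thesis
    using q(2) by (simp add: k q_int_nat eq_divide_eq)
qed

text \<open>Serves the induction that counts the hyperplanes above a \<open>k\<close>-dimensional
  subspace of codimension n + 2. After multiplication by q - 1 both sides contain the factor q^k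
  (q^(n+1) - 1), which is nonzero because its exponent n + 1 is positive.\<close>

lemma q_int_hyperplane_step:
  assumes "q \<ge> 2"
    and "c * (of_nat q ^ (k + Suc n) - of_nat q ^ k) =
      q_int q (int (Suc n)) * (of_nat q ^ (k + Suc (Suc n)) - of_nat q ^ k)"
  shows "c = q_int q (int (Suc (Suc n)))"
proof -
  let ?q = "of_nat q :: complex"
  have q: "?q \<noteq> 0" "?q - 1 \<noteq> 0"
    using assms(1) of_nat_eq_1_iff[of q, where ?'a = complex] by auto
  have "?q ^ Suc n \<noteq> 1"
    using assms(1) one_less_power[of q "Suc n"]
    by (simp only: of_nat_power[symmetric] of_nat_eq_1_iff) simp
  then have ne: "?q ^ k * (?q ^ Suc n - 1) \<noteq> 0"
    using q by simp
  have "(?q ^ k * (?q ^ Suc n - 1)) * (c * (?q - 1)) =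
      (c * (?q ^ (k + Suc n) - ?q ^ k)) * (?q - 1)"
    by (simp add: power_add algebra_simps)
  also have "\<dots> = (?q ^ Suc n - 1) * (?q ^ (k + Suc (Suc n)) - ?q ^ k)"
    unfolding assms(2) q_int_nat using q(2) by (simp del: power_Suc)
  also have "\<dots> = (?q ^ k * (?q ^ Suc n - 1)) * (?q ^ Suc (Suc n) - 1)"
    by (simp add: power_add algebra_simps)
  finally have "c * (?q - 1) = ?q ^ Suc (Suc n) - 1"
    using ne mult_left_cancel by blast
  then show ?thesis
    unfolding q_int_nat using q(2) by (simp add: eq_divide_eq)
qed

text \<open>Settles the coordinates \<open>y\<close> with \<open>\<alpha> \<subseteq> y\<close>: the
  neighbour count on the left splits into the eigenvalue and the contribution of the [i] subspaces
  covered by \<open>\<alpha>\<close>. Writing D = i + k and N = i + k + l makes every exponent a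
  natural number; clearing denominators then leaves an identity between powers of q.\<close>

lemma grassmann_eigenvalue_count:
  assumes "q \<ge> 2" "i \<le> D" "D \<le> N"
  shows "q_int q (int D - int i) * (q_int q (int N - int D + 1) - 1) =
    grassmann_eigenvalue q N D i + q_int q (int D - int i + 1) * q_int q (int i)"
proof -
  let ?q = "of_nat q :: complex"
  have q: "?q - 1 \<noteq> 0"
    using assms(1) of_nat_eq_1_iff[of q, where ?'a = complex] by auto
  obtain k where D: "D = i + k"
    using assms(2) le_Suc_ex by blast
  obtain l where N: "N = i + k + l"
    using assms(3) le_Suc_ex D by blast
  have *: "int D - int i = int k" "int k + 1 = int (Suc k)" "int N - int D = int l"
    "int l + 1 = int (Suc l)" "int N - int i = int (k + l)" "int (k + l) + 1 = int (Suc (k + l))"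
    by (simp_all add: D N)
  have [simp]: "?q \<noteq> 1"
    using q by simp
  show ?thesis
    unfolding grassmann_eigenvalue_def * q_int_nat unfolding D
    by (simp add: divide_simps) (simp add: power_add algebra_simps)
qed

section \<open>Sizes of subspaces over a finite field\<close>

locale finite_field_vector_space = finite_dimensional_vector_space scale Basis
  for scale :: "'a :: {field, finite} \<Rightarrow> 'v :: ab_group_add \<Rightarrow> 'v" and Basis
begin

lemma card_field_ge_2: "CARD('a) \<ge> 2"
proof -
  have "card {0, 1 :: 'a} \<le> CARD('a)"
    by (intro card_mono) auto
  then show ?thesis
    by simp
qed

text \<open>Induction on \<open>B\<close>: as \<open>b\<close> lies outside \<open>span B\<close>,
  every vector of the larger span is k b + s for exactly one scalar k and one s in
  \<open>span B\<close>, so each basis vector multiplies the size by q.\<close>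

lemma card_span_independent:
  "finite B \<Longrightarrow> independent B \<Longrightarrow> card (span B) = CARD('a) ^ card B"
proof (induction B rule: finite_induct)
  case empty
  show ?case
    by simp
next
  case (insert b B)
  then have b: "b \<notin> span B" and ind: "independent B"
    by (auto simp: independent_insert)
  have "bij_betw (\<lambda>(k, s). scale k b + s) (UNIV \<times> span B) (span (insert b B))"
  proof (rule bij_betw_imageI)
    show "inj_on (\<lambda>(k, s). scale k b + s) (UNIV \<times> span B)"
    proof (rule inj_onI, clarify)
      fix k s l t
      assume st: "s \<in> span B" "t \<in> span B" and eq: "scale k b + s = scale l b + t"
      then have "scale (k - l) b = t - s"
        by (simp add: scale_left_diff_distrib algebra_simps)
      then have mem: "scale (k - l) b \<in> span B"
        using st span_diff by simp
      have "k = l"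
      proof (rule ccontr)
        assume "k \<noteq> l"
        then have "b = scale (inverse (k - l)) (scale (k - l) b)"
          by simp
        then show False
          using b mem span_scale by metis
      qed
      then show "k = l \<and> s = t"
        using eq by simp
    qed
    show "(\<lambda>(k, s). scale k b + s) ` (UNIV \<times> span B) = span (insert b B)"
    proof (intro set_eqI iffI)
      fix v
      assume "v \<in> (\<lambda>(k, s). scale k b + s) ` (UNIV \<times> span B)"
      then obtain k s where "v = scale k b + s" "s \<in> span B"
        by auto
      then have "v - scale k b \<in> span B"
        by simp
      then show "v \<in> span (insert b B)"
        unfolding span_breakdown_eq by blast
    next
      fix v
      assume "v \<in> span (insert b B)"
      then obtain k where "v - scale k b \<in> span B"
        by (auto simp: span_breakdown_eq)
      then show "v \<in> (\<lambda>(k, s). scale k b + s) ` (UNIV \<times> span B)"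
        by (intro image_eqI[of _ _ "(k, v - scale k b)"]) auto
    qed
  qed
  then have "card (span (insert b B)) = CARD('a) * card (span B)"
    by (metis bij_betw_same_card card_cartesian_product)
  then show ?case
    using insert ind by simp
qed

lemma card_subspace: "subspace S \<Longrightarrow> card S = CARD('a) ^ dim S"
  using card_span_independent by (elim basis_subspace_exists) auto

text \<open>An infinite set has \<open>card\<close> 0, whereas the size formula gives the whole
  space a nonzero \<open>card\<close>.\<close>

lemma finite_vectors: "finite (UNIV :: 'v set)"
proof (rule card_ge_0_finite)
  show "card (UNIV :: 'v set) > 0"
    using card_subspace[OF subspace_UNIV] card_field_ge_2 by simp
qed

lemma finite_vector_set [simp]: "finite (A :: 'v set)"
  by (rule finite_subset[OF subset_UNIV finite_vectors])

lemma finite_vector_set_set [simp]: "finite (A :: 'v set set)"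
  by (rule finite_subset[OF _ finite_Pow_iff[THEN iffD2, OF finite_vectors]]) auto

text \<open>The difference of powers is taken in the complex numbers, where subtraction is not
  truncated.\<close>

lemma card_subspace_diff:
  assumes "subspace S" "subspace T" "S \<subseteq> T"
  shows "of_nat (card (T - S)) = (of_nat CARD('a) ^ dim T - of_nat CARD('a) ^ dim S :: complex)"
proof -
  have "card (T - S) + CARD('a) ^ dim S = CARD('a) ^ dim T"
    using assms card_mono[of T S]
    by (simp add: card_Diff_subset flip: card_subspace)
  then show ?thesis
    by (metis add_diff_cancel_right' of_nat_add of_nat_power)
qed

section \<open>Numbers of covers and of hyperplanes\<close>

lemma dim_span_insert:
  "subspace W \<Longrightarrow> v \<notin> W \<Longrightarrow> dim (span (insert v W)) = dim W + 1"
  by (metis dim_insert dim_span span_eq_iff)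

text \<open>Double count of the pairs of a vector v in \<open>Y - W\<close> and a cover of
  \<open>W\<close> inside \<open>Y\<close> that contains v. Each v lies in exactly one such cover,
  \<open>span (insert v W)\<close>, and each cover has q^(d+1) - q^d vectors outside
  \<open>W\<close>, where d is the dimension of \<open>W\<close>.\<close>

lemma card_covers_within:
  assumes "subspace W" "subspace Y" "W \<subseteq> Y"
  shows "of_nat (card {Z. covers scale Z W \<and> Z \<subseteq> Y}) =
    q_int CARD('a) (int (dim Y) - int (dim W))"
proof (rule q_int_eqI[OF card_field_ge_2 dim_subset[OF assms(3)]])
  let ?C = "{Z. covers scale Z W \<and> Z \<subseteq> Y}"
  let ?T = "Y - W"
  have one: "card {Z \<in> ?C. v \<in> Z} = 1" if v: "v \<in> ?T" for v
  proof -
    have "{Z \<in> ?C. v \<in> Z} = {span (insert v W)}"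
    proof (intro set_eqI iffI)
      fix Z
      assume "Z \<in> {Z \<in> ?C. v \<in> Z}"
      then have Z: "subspace Z" "W \<subseteq> Z" "v \<in> Z" "dim Z = dim W + 1"
        by (auto simp: covers_def)
      then have "span (insert v W) \<subseteq> Z"
        by (intro span_minimal) auto
      then have "span (insert v W) = Z"
        using Z v assms dim_span_insert[of W v] by (intro subspace_dim_equal) auto
      then show "Z \<in> {span (insert v W)}"
        by simp
    next
      fix Z
      assume "Z \<in> {span (insert v W)}"
      then have Z: "Z = span (insert v W)"
        by simp
      have "Z \<subseteq> Y"
        unfolding Z using v assms by (intro span_minimal) auto
      moreover have "insert v W \<subseteq> Z"
        unfolding Z by (rule span_superset)
      ultimately show "Z \<in> {Z \<in> ?C. v \<in> Z}"
        using Z v assms dim_span_insert[of W v] by (auto simp: covers_def)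
    qed
    then show ?thesis
      by simp
  qed
  have "(\<Sum>Z\<in>?C. card {v \<in> ?T. v \<in> Z}) = 1 * card ?T"
    using one by (intro sum_multicount) auto
  then have "of_nat (card ?T) = (\<Sum>Z\<in>?C. of_nat (card {v \<in> ?T. v \<in> Z}) :: complex)"
    by (simp flip: of_nat_sum)
  also have "\<dots> = (\<Sum>Z\<in>?C. of_nat CARD('a) ^ Suc (dim W) - of_nat CARD('a) ^ dim W)"
  proof (rule sum.cong)
    fix Z
    assume "Z \<in> ?C"
    then have Z: "subspace Z" "W \<subseteq> Z" "Z \<subseteq> Y" "dim Z = Suc (dim W)"
      by (auto simp: covers_def)
    then have "{v \<in> ?T. v \<in> Z} = Z - W"
      by auto
    then show "of_nat (card {v \<in> ?T. v \<in> Z}) =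
        (of_nat CARD('a) ^ Suc (dim W) - of_nat CARD('a) ^ dim W :: complex)"
      using card_subspace_diff[of W Z] Z assms by simp
  qed simp
  finally show "of_nat (card ?C) * (of_nat CARD('a) ^ Suc (dim W) - of_nat CARD('a) ^ dim W) =
      (of_nat CARD('a) ^ dim Y - of_nat CARD('a) ^ dim W :: complex)"
    using card_subspace_diff[OF assms] by simp
qed

text \<open>Dual to the count of covers, but a vector now lies in several hyperplanes, so the double
  count of pairs of v in \<open>Y - W\<close> and a hyperplane H above \<open>W\<close> with v in H
  becomes an induction on the codimension of \<open>W\<close>. The hyperplanes above
  \<open>W\<close> through v are those above \<open>span (insert v W)\<close>, whose codimension is
  smaller by one.\<close>

lemma card_hyperplanes_containing:
  assumes "subspace W" "subspace Y" "W \<subseteq> Y"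
  shows "of_nat (card {H. covers scale Y H \<and> W \<subseteq> H}) =
    q_int CARD('a) (int (dim Y) - int (dim W))"
proof -
  have "of_nat (card {H. covers scale Y H \<and> W \<subseteq> H}) = q_int CARD('a) (int n)"
    if "subspace W" "W \<subseteq> Y" "dim Y = dim W + n" for n W
    using that
  proof (induction n arbitrary: W rule: less_induct)
    case (less n)
    let ?S = "{H. covers scale Y H \<and> W \<subseteq> H}"
    \<comment> \<open>Codimension 1 is a separate base case: there H = W, both sides of the double
      count vanish, and nothing could be cancelled.\<close>
    consider "n = 0" | "n = 1" | m where "n = Suc (Suc m)"
    proof (cases n)
      case (Suc k)
      then show ?thesis
        using that(2,3) by (cases k) simp_all
    qed (use that(1) in simp)
    then show ?case
    proof cases
      case 1
      have "\<not> (covers scale Y H \<and> W \<subseteq> H)" for H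
        using less.prems 1 dim_subset[of W H] by (auto simp: covers_def)
      then have "?S = {}"
        by blast
      then have "card ?S = 0"
        by simp
      then show ?thesis
        using 1 by simp
    next
      case 2
      have "W = H" if "covers scale Y H \<and> W \<subseteq> H" for H
        using that less.prems 2 by (intro subspace_dim_equal) (auto simp: covers_def)
      moreover have "covers scale Y W"
        using less.prems 2 assms by (simp add: covers_def)
      ultimately have "?S = {W}"
        by blast
      then have "card ?S = 1"
        by simp
      then show ?thesis
        using 2 card_field_ge_2 by simp
    next
      case (3 m)
      let ?T = "Y - W"
      have IH: "of_nat (card {H \<in> ?S. v \<in> H}) = q_int CARD('a) (int (Suc m))"
        if v: "v \<in> ?T" for v
      proof -
        have "{H \<in> ?S. v \<in> H} = {H. covers scale Y H \<and> span (insert v W) \<subseteq> H}"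
          using span_superset[of "insert v W"] span_minimal[of "insert v W"]
          by (auto simp: covers_def)
        moreover have "span (insert v W) \<subseteq> Y"
          using v less.prems assms by (intro span_minimal) auto
        ultimately show ?thesis
          using less.IH[of "Suc m" "span (insert v W)"] v less.prems 3 dim_span_insert[of W v]
          by simp
      qed
      have "(\<Sum>H\<in>?S. card {v \<in> ?T. v \<in> H}) = (\<Sum>v\<in>?T. card {H \<in> ?S. v \<in> H})"
        by (intro sum_multicount_gen) auto
      then have "(\<Sum>H\<in>?S. of_nat (card {v \<in> ?T. v \<in> H}) :: complex) =
          (\<Sum>v\<in>?T. of_nat (card {H \<in> ?S. v \<in> H}))"
        by (simp flip: of_nat_sum)
      moreover have "of_nat (card {v \<in> ?T. v \<in> H}) =
          (of_nat CARD('a) ^ (dim W + Suc m) - of_nat CARD('a) ^ dim W :: complex)"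
        if "H \<in> ?S" for H
      proof -
        have H: "subspace H" "W \<subseteq> H" "H \<subseteq> Y" "dim H = dim W + Suc m"
          using that less.prems 3 by (auto simp: covers_def)
        then have "{v \<in> ?T. v \<in> H} = H - W"
          by auto
        then show ?thesis
          using card_subspace_diff[of W H] H less.prems by simp
      qed
      ultimately have "of_nat (card ?S) *
          (of_nat CARD('a) ^ (dim W + Suc m) - of_nat CARD('a) ^ dim W) =
          q_int CARD('a) (int (Suc m)) * of_nat (card ?T)"
        using IH by (simp add: mult.commute)
      then show ?thesis
        unfolding 3
        using card_subspace_diff[of W Y] less.prems 3 assms
        by (intro q_int_hyperplane_step[OF card_field_ge_2]) simp
    qed
  qed
  moreover obtain n where n: "dim Y = dim W + n"
    using dim_subset[OF assms(3)] le_Suc_ex by blast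
  ultimately have "of_nat (card {H. covers scale Y H \<and> W \<subseteq> H}) = q_int CARD('a) (int n)"
    using assms by blast
  then show ?thesis
    by (simp add: n)
qed

section \<open>Coordinates of the two sides as cardinalities\<close>

lemma vee_eq:
  "vee scale D \<alpha> z = of_bool (z \<in> grassmann_verts scale D \<and> \<alpha> \<subseteq> z)"
proof -
  have "vee scale D \<alpha> z = (\<Sum>y | y \<in> grassmann_verts scale D \<and> \<alpha> \<subseteq> y. if z = y then 1 else 0)"
    by (simp add: vee_def unit_vec_def)
  also have "\<dots> = of_bool (z \<in> grassmann_verts scale D \<and> \<alpha> \<subseteq> z)"
    by (simp only: sum.delta'[OF finite_vector_set_set]) (simp add: of_bool_def)
  finally show ?thesis .
qed

lemma mat_vec_mult_vee:
  "mat_vec_mult (grassmann_verts scale D) (grassmann_matrix scale D) (vee scale D \<alpha>) y =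
    of_nat (card {z. grassmann_adj scale D y z \<and> \<alpha> \<subseteq> z})"
proof -
  have "mat_vec_mult (grassmann_verts scale D) (grassmann_matrix scale D) (vee scale D \<alpha>) y =
      (\<Sum>z\<in>grassmann_verts scale D. if grassmann_adj scale D y z \<and> \<alpha> \<subseteq> z then 1 else 0)"
    unfolding mat_vec_mult_def
    by (intro sum.cong) (auto simp: grassmann_matrix_def vee_eq)
  also have "\<dots> = of_nat (card {z \<in> grassmann_verts scale D. grassmann_adj scale D y z \<and> \<alpha> \<subseteq> z})"
    by (simp add: sum.If_cases Int_def)
  also have "{z \<in> grassmann_verts scale D. grassmann_adj scale D y z \<and> \<alpha> \<subseteq> z} =
      {z. grassmann_adj scale D y z \<and> \<alpha> \<subseteq> z}"
    by (auto simp: grassmann_adj_def)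
  finally show ?thesis .
qed

lemma sum_vee_covered:
  "(\<Sum>\<beta> | covers scale \<alpha> \<beta>. vee scale D \<beta> y) =
    of_bool (y \<in> grassmann_verts scale D) * of_nat (card {\<beta>. covers scale \<alpha> \<beta> \<and> \<beta> \<subseteq> y})"
  by (simp add: vee_eq of_bool_def sum.If_cases Int_def)

section \<open>Neighbours of \<open>y\<close> that contain \<open>\<alpha>\<close>\<close>

lemma adj_iff_covers:
  "grassmann_adj scale D y z \<longleftrightarrow>
    y \<in> grassmann_verts scale D \<and> z \<in> grassmann_verts scale D \<and> covers scale y (y \<inter> z)"
  \<comment> \<open>The condition dim = D - 1 is an equation of integers, so it says D = dim + 1
    even for D = 0, where it has no solution.\<close>
  by (auto simp: grassmann_adj_def grassmann_verts_def covers_def subspace_inter)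

text \<open>A neighbour \<open>z\<close> of \<open>y\<close> is determined by the hyperplane \<open>y \<inter> z\<close> of \<open>y\<close> together with a
  cover of that hyperplane different from \<open>y\<close>.\<close>

lemma card_adj_containing_of_subset:
  assumes y: "y \<in> grassmann_verts scale D" and \<alpha>: "subspace \<alpha>" "\<alpha> \<subseteq> y"
  shows "of_nat (card {z. grassmann_adj scale D y z \<and> \<alpha> \<subseteq> z}) =
    q_int CARD('a) (int D - int (dim \<alpha>)) *
      (q_int CARD('a) (int (dim UNIV) - int D + 1) - 1)"
proof -
  let ?H = "{w. covers scale y w \<and> \<alpha> \<subseteq> w}"
  let ?C = "\<lambda>w. {z. covers scale z w} - {y}"
  have ysub: "subspace y" "dim y = D"
    using y by (auto simp: grassmann_verts_def)
  have meet: "y \<inter> z = w" if "w \<in> ?H" "z \<in> ?C w" for w z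
  proof -
    have w: "subspace w" "w \<subseteq> y" "D = dim w + 1"
      and z: "subspace z" "w \<subseteq> z" "dim z = D" "z \<noteq> y"
      using that ysub by (auto simp: covers_def)
    \<comment> \<open>An intersection of dimension \<open>D\<close> would equal both
      \<open>y\<close> and \<open>z\<close>. Hence its dimension is at most D - 1, that of
      \<open>w\<close>, and it contains \<open>w\<close>.\<close>
    have "\<not> D \<le> dim (y \<inter> z)"
    proof
      assume "D \<le> dim (y \<inter> z)"
      then have "y \<inter> z = y"
        using z ysub by (intro subspace_dim_equal subspace_inter) auto
      moreover have "y \<inter> z = z"
        using \<open>D \<le> dim (y \<inter> z)\<close> z ysub by (intro subspace_dim_equal subspace_inter) auto
      ultimately show False
        using z by simp
    qed
    then have "w = y \<inter> z"
      using w z ysub by (intro subspace_dim_equal subspace_inter) auto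
    then show ?thesis
      by simp
  qed
  have union: "{z. grassmann_adj scale D y z \<and> \<alpha> \<subseteq> z} = (\<Union>w\<in>?H. ?C w)"
  proof (intro set_eqI iffI)
    fix z
    assume "z \<in> {z. grassmann_adj scale D y z \<and> \<alpha> \<subseteq> z}"
    then have z: "subspace z" "dim z = D" "\<alpha> \<subseteq> z" "covers scale y (y \<inter> z)"
      by (auto simp: adj_iff_covers grassmann_verts_def)
    have "covers scale z (y \<inter> z)"
      using z ysub(2) unfolding covers_def by simp
    moreover have "z \<noteq> y"
      using z(4) unfolding covers_def by auto
    ultimately have "z \<in> ?C (y \<inter> z)"
      by simp
    then show "z \<in> (\<Union>w\<in>?H. ?C w)"
      using z(3,4) \<alpha>(2) by (intro UN_I[of "y \<inter> z"]) simp_all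
  next
    fix z
    assume "z \<in> (\<Union>w\<in>?H. ?C w)"
    then obtain w where w: "w \<in> ?H" "z \<in> ?C w"
      by blast
    then show "z \<in> {z. grassmann_adj scale D y z \<and> \<alpha> \<subseteq> z}"
      using meet[OF w] y ysub by (auto simp: adj_iff_covers grassmann_verts_def covers_def)
  qed
  have "card (\<Union>w\<in>?H. ?C w) = (\<Sum>w\<in>?H. card (?C w))"
  proof (rule card_UN_disjoint)
    show "\<forall>v\<in>?H. \<forall>w\<in>?H. v \<noteq> w \<longrightarrow> ?C v \<inter> ?C w = {}"
      using meet by blast
  qed auto
  then have "of_nat (card {z. grassmann_adj scale D y z \<and> \<alpha> \<subseteq> z}) =
      (\<Sum>w\<in>?H. of_nat (card (?C w)) :: complex)"
    by (simp add: union)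
  \<comment> \<open>Since \<open>w\<close> has dimension D - 1, it has [N - D + 1] covers in the
    whole space, N being its dimension; one of them is \<open>y\<close>, whence the term -1.\<close>
  also have "\<dots> = (\<Sum>w\<in>?H. q_int CARD('a) (int (dim UNIV) - int D + 1) - 1)"
  proof (rule sum.cong)
    fix w
    assume "w \<in> ?H"
    then have w: "subspace w" "int (dim w) = int D - 1" "covers scale y w"
      using ysub by (auto simp: covers_def)
    then have "card {z. covers scale z w} = Suc (card (?C w))"
      by (metis card.remove finite_vector_set_set mem_Collect_eq)
    moreover have "of_nat (card {z. covers scale z w}) =
        q_int CARD('a) (int (dim UNIV) - int D + 1)"
      using card_covers_within[of w UNIV] w by (simp add: algebra_simps)
    ultimately show "of_nat (card (?C w)) = q_int CARD('a) (int (dim UNIV) - int D + 1) - 1"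
      by (metis add_diff_cancel_left' of_nat_Suc)
  qed simp
  finally show ?thesis
    using card_hyperplanes_containing[OF \<alpha>(1) ysub(1) \<alpha>(2)] ysub(2) by simp
qed

text \<open>When \<open>\<alpha> \<inter> y\<close> is a hyperplane of \<open>\<alpha>\<close>, a neighbour \<open>z \<supseteq> \<alpha>\<close> of \<open>y\<close> is recovered from
  \<open>w = y \<inter> z\<close> as \<open>\<alpha> + w\<close>.\<close>

lemma card_adj_containing_of_covers:
  assumes y: "y \<in> grassmann_verts scale D" and c: "covers scale \<alpha> (\<alpha> \<inter> y)"
  shows "of_nat (card {z. grassmann_adj scale D y z \<and> \<alpha> \<subseteq> z}) =
    q_int CARD('a) (int D - int (dim \<alpha>) + 1)"
proof -
  let ?H = "{w. covers scale y w \<and> \<alpha> \<inter> y \<subseteq> w}"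
  let ?Z = "{z. grassmann_adj scale D y z \<and> \<alpha> \<subseteq> z}"
  have ysub: "subspace y" "dim y = D" and asub: "subspace \<alpha>" "subspace (\<alpha> \<inter> y)"
    and da: "dim \<alpha> = dim (\<alpha> \<inter> y) + 1"
    using y c by (auto simp: grassmann_verts_def covers_def)
  let ?f = "\<lambda>w. span (\<alpha> \<union> w)"
  have f: "dim (?f w) = D" "\<alpha> \<subseteq> ?f w" "w \<subseteq> ?f w" "y \<inter> ?f w = w" if "w \<in> ?H" for w
  proof -
    have w: "subspace w" "w \<subseteq> y" "D = dim w + 1" "\<alpha> \<inter> y \<subseteq> w"
      using that ysub by (auto simp: covers_def)
    have aw: "\<alpha> \<inter> w = \<alpha> \<inter> y"
      using w by blast
    \<comment> \<open>Dimension formula for \<open>\<alpha>\<close> and \<open>w\<close>: as their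
      intersection is \<open>\<alpha> \<inter> y\<close>, a hyperplane of \<open>\<alpha>\<close>,
      their sum has dimension 1 + dim w.\<close>
    show d: "dim (?f w) = D"
    proof -
      have "?f w = {a + b |a b. a \<in> \<alpha> \<and> b \<in> w}"
        using span_Un[of \<alpha> w] span_eq_iff[THEN iffD2, OF asub(1)] span_eq_iff[THEN iffD2, OF w(1)]
        by (simp only:)
      then show ?thesis
        using dim_sums_Int[OF asub(1) w(1)] aw da w(3) by (simp del: dim_span)
    qed
    show sub: "\<alpha> \<subseteq> ?f w" "w \<subseteq> ?f w"
      using span_superset[of "\<alpha> \<union> w"] by auto
    \<comment> \<open>Otherwise the sum, and with it \<open>\<alpha>\<close>, would lie in
      \<open>y\<close>, although \<open>\<alpha> \<inter> y\<close> is smaller than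
      \<open>\<alpha>\<close>.\<close>
    have "\<not> D \<le> dim (y \<inter> ?f w)"
    proof
      assume "D \<le> dim (y \<inter> ?f w)"
      then have "y \<inter> ?f w = ?f w"
        using d ysub by (intro subspace_dim_equal subspace_inter subspace_span) auto
      then have "\<alpha> \<inter> y = \<alpha>"
        using sub by blast
      then show False
        using da by simp
    qed
    then have "dim (y \<inter> ?f w) \<le> dim w"
      using w(3) by simp
    then have "w = y \<inter> ?f w"
      using w(1,2) ysub(1) sub(2)
      by (intro subspace_dim_equal subspace_inter subspace_span Int_greatest)
    then show "y \<inter> ?f w = w"
      by simp
  qed
  have "bij_betw ?f ?H ?Z"
  proof (rule bij_betw_byWitness[where f' = "\<lambda>z. y \<inter> z"])
    show "\<forall>w\<in>?H. y \<inter> ?f w = w"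
      by (intro ballI f(4))
    show "?f ` ?H \<subseteq> ?Z"
    proof (rule image_subsetI)
      fix w
      assume w: "w \<in> ?H"
      then have "covers scale y (y \<inter> ?f w)"
        by (simp only: f(4)[OF w]) simp
      then show "?f w \<in> ?Z"
        using f(1,2)[OF w] y by (simp add: adj_iff_covers grassmann_verts_def del: dim_span)
    qed
    show "(\<lambda>z. y \<inter> z) ` ?Z \<subseteq> ?H"
      by (auto simp: adj_iff_covers)
    show "\<forall>z\<in>?Z. ?f (y \<inter> z) = z"
    proof
      fix z
      assume z: "z \<in> ?Z"
      then have zsub: "subspace z" "dim z = D" "\<alpha> \<subseteq> z" "y \<inter> z \<in> ?H"
        by (auto simp: adj_iff_covers grassmann_verts_def)
      \<comment> \<open>The sum lies in \<open>z\<close>, and both have dimension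
        \<open>D\<close>.\<close>
      then show "?f (y \<inter> z) = z"
        using f(1)[of "y \<inter> z"] by (intro subspace_dim_equal span_minimal) auto
    qed
  qed
  then have "card ?Z = card ?H"
    by (metis bij_betw_same_card)
  \<comment> \<open>The subspace \<open>\<alpha> \<inter> y\<close> has dimension i - 1 with i =
    \<open>dim \<alpha>\<close>, so its codimension in \<open>y\<close> is D - i + 1.\<close>
  moreover have "of_nat (card ?H) = q_int CARD('a) (int D - int (dim \<alpha>) + 1)"
    using card_hyperplanes_containing[OF asub(2) ysub(1)] ysub(2) da by (simp add: algebra_simps)
  ultimately show ?thesis
    by simp
qed

text \<open>Both \<open>\<alpha>\<close> and \<open>y \<inter> z\<close> lie in \<open>z\<close>, so
  their sum has dimension at most \<open>D\<close>, one more than that of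
  \<open>y \<inter> z\<close>. By the dimension formula \<open>\<alpha>\<close> exceeds
  \<open>\<alpha> \<inter> y\<close> by at most one dimension, and by at least one because
  \<open>\<alpha>\<close> is not inside \<open>y\<close>.\<close>

lemma covers_Int_of_adj:
  assumes \<alpha>: "subspace \<alpha>" "\<not> \<alpha> \<subseteq> y" and z: "grassmann_adj scale D y z" "\<alpha> \<subseteq> z"
  shows "covers scale \<alpha> (\<alpha> \<inter> y)"
proof -
  let ?s = "{a + b |a b. a \<in> \<alpha> \<and> b \<in> y \<inter> z}"
  have sub: "subspace y" "dim y = D" "subspace z" "dim z = D" "D = dim (y \<inter> z) + 1"
    using z by (auto simp: adj_iff_covers grassmann_verts_def covers_def)
  have "?s \<subseteq> z"
    using z sub by (auto intro: subspace_add)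
  then have "dim ?s \<le> D"
    using dim_subset[of ?s z] sub(4) by simp
  moreover have "dim ?s + dim (\<alpha> \<inter> (y \<inter> z)) = dim \<alpha> + dim (y \<inter> z)"
    using \<alpha> sub by (intro dim_sums_Int subspace_inter)
  moreover have "\<alpha> \<inter> (y \<inter> z) = \<alpha> \<inter> y"
    using z by blast
  ultimately have "dim \<alpha> \<le> dim (\<alpha> \<inter> y) + 1"
    using sub by simp
  moreover have "\<not> dim \<alpha> \<le> dim (\<alpha> \<inter> y)"
    using subspace_dim_equal[of "\<alpha> \<inter> y" \<alpha>] \<alpha> sub by (auto simp: subspace_inter)
  ultimately show ?thesis
    using \<alpha> sub by (auto simp: covers_def subspace_inter)
qed

text \<open>The intersection lies strictly between \<open>\<beta>\<close> and
  \<open>\<alpha>\<close> or equals \<open>\<beta>\<close>, and codimension one leaves no room in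
  between. So at most one \<open>\<beta>\<close> contributes to a coordinate \<open>y\<close> that
  does not contain \<open>\<alpha>\<close>.\<close>

lemma covered_eq_Int:
  assumes "subspace y" "\<not> \<alpha> \<subseteq> y" "covers scale \<alpha> \<beta>" "\<beta> \<subseteq> y"
  shows "\<beta> = \<alpha> \<inter> y"
proof (rule subspace_dim_equal)
  have \<alpha>: "subspace \<alpha>" "dim \<alpha> = dim \<beta> + 1"
    using assms by (auto simp: covers_def)
  have "\<not> dim \<alpha> \<le> dim (\<alpha> \<inter> y)"
    using subspace_dim_equal[of "\<alpha> \<inter> y" \<alpha>] \<alpha> assms by (auto simp: subspace_inter)
  then show "dim (\<alpha> \<inter> y) \<le> dim \<beta>"
    using \<alpha> by simp
qed (use assms in \<open>auto simp: covers_def subspace_inter\<close>)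

section \<open>Comparison of the two sides in each coordinate\<close>

theorem grassmann_matrix_vee:
  assumes \<alpha>: "subspace \<alpha>" "dim \<alpha> \<le> D" and D: "D \<le> dim (UNIV :: 'v set)"
  shows "mat_vec_mult (grassmann_verts scale D) (grassmann_matrix scale D) (vee scale D \<alpha>) y =
    grassmann_eigenvalue CARD('a) (dim (UNIV :: 'v set)) D (dim \<alpha>) * vee scale D \<alpha> y
      + q_int CARD('a) (int D - int (dim \<alpha>) + 1)
        * (\<Sum>\<beta> | covers scale \<alpha> \<beta>. vee scale D \<beta> y)"
proof -
  let ?Z = "{z. grassmann_adj scale D y z \<and> \<alpha> \<subseteq> z}"
  let ?B = "{\<beta>. covers scale \<alpha> \<beta> \<and> \<beta> \<subseteq> y}"
  consider "y \<notin> grassmann_verts scale D"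
    | "y \<in> grassmann_verts scale D" "\<alpha> \<subseteq> y"
    | "y \<in> grassmann_verts scale D" "\<not> \<alpha> \<subseteq> y" "covers scale \<alpha> (\<alpha> \<inter> y)"
    | "y \<in> grassmann_verts scale D" "\<not> \<alpha> \<subseteq> y" "\<not> covers scale \<alpha> (\<alpha> \<inter> y)"
    by blast
  then show ?thesis
  proof cases
    case 1
    then have "?Z = {}"
      by (auto simp: grassmann_adj_def)
    then show ?thesis
      using 1 by (simp add: mat_vec_mult_vee sum_vee_covered vee_eq[of D \<alpha> y])
  next
    case 2
    \<comment> \<open>Every hyperplane of \<open>\<alpha>\<close> lies in \<open>y\<close> here;
      requiring it to contain the zero subspace turns the hyperplane count into [i] with i =
      \<open>dim \<alpha>\<close>.\<close>
    have "?B = {\<beta>. covers scale \<alpha> \<beta> \<and> {0} \<subseteq> \<beta>}"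
      using 2 by (auto simp: covers_def subspace_0)
    moreover have "of_nat (card {\<beta>. covers scale \<alpha> \<beta> \<and> {0} \<subseteq> \<beta>}) =
        q_int CARD('a) (int (dim \<alpha>) - int (dim {0 :: 'v}))"
      using \<alpha> by (intro card_hyperplanes_containing) (auto simp: subspace_0)
    ultimately have "of_nat (card ?B) = q_int CARD('a) (int (dim \<alpha>))"
      by simp
    then show ?thesis
      using 2 card_adj_containing_of_subset[OF 2(1) \<alpha>(1) 2(2)]
        grassmann_eigenvalue_count[OF card_field_ge_2 \<alpha>(2) D]
      by (simp add: mat_vec_mult_vee sum_vee_covered vee_eq[of D \<alpha> y])
  next
    case 3
    have "\<beta> = \<alpha> \<inter> y" if "\<beta> \<in> ?B" for \<beta>
      using 3 that by (intro covered_eq_Int) (auto simp: grassmann_verts_def)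
    then have "?B = {\<alpha> \<inter> y}"
      using 3(3) by blast
    then have "card ?B = 1"
      by simp
    then show ?thesis
      using 3 card_adj_containing_of_covers[OF 3(1) 3(3)]
      by (simp add: mat_vec_mult_vee sum_vee_covered vee_eq[of D \<alpha> y])
  next
    case 4
    have "\<beta> = \<alpha> \<inter> y" if "\<beta> \<in> ?B" for \<beta>
      using 4 that by (intro covered_eq_Int) (auto simp: grassmann_verts_def)
    then have "?B = {}"
      using 4(3) by blast
    moreover have "?Z = {}"
      using 4 covers_Int_of_adj[OF \<alpha>(1)] by blast
    ultimately show ?thesis
      using 4 by (simp only: mat_vec_mult_vee sum_vee_covered vee_eq[of D \<alpha> y]) simp
  qed
qed

end

text \<open>The dimension is the \<open>card\<close> of a basis, and an infinite basis would give
  0.\<close>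

lemma (in vector_space) finite_basis_if_dim_pos:
  assumes "dim (UNIV :: 'b set) > 0"
  obtains B where "finite B" "independent B" "span B = UNIV"
proof -
  obtain B where "independent B" "UNIV \<subseteq> span B" "card B = dim (UNIV :: 'b set)"
    using basis_exists[of UNIV] by metis
  then show ?thesis
    using that[of B] assms card_ge_0_finite[of B] by auto
qed

theorem theorem8p1:
  fixes scale :: "'a :: {field, finite} \<Rightarrow> 'v :: ab_group_add \<Rightarrow> 'v"
    and q N D i :: nat and x \<alpha> :: "'v set"
  assumes "vector_space scale"
    and "q = CARD('a)"
    and "vector_space.dim scale (UNIV :: 'v set) = N"
    and "D \<ge> 1" and "N > 2 * D"
    and "x \<in> grassmann_verts scale D"
    and "module.subspace scale \<alpha>" and "\<alpha> \<subseteq> x"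
    and "i = vector_space.dim scale \<alpha>"
  shows "mat_vec_mult (grassmann_verts scale D)
           (grassmann_matrix scale D) (vee scale D \<alpha>) =
         (\<lambda>y. grassmann_eigenvalue q N D i * vee scale D \<alpha> y
            + q_int q (int D - int i + 1)
              * (\<Sum>\<beta> | covers scale \<alpha> \<beta>. vee scale D \<beta> y))"
proof -
  interpret vector_space scale
    by fact
  \<comment> \<open>From N > 2D the dimension N is positive, which rules out its default value
    0.\<close>
  obtain B where "finite B" "independent B" "span B = UNIV"
    using finite_basis_if_dim_pos assms(3,5) by auto
  then interpret finite_field_vector_space scale B
    by unfold_locales
  have "i \<le> D"
    using assms dim_subset[of \<alpha> x] by (auto simp: grassmann_verts_def)
  moreover have "D \<le> N"
    using assms(5) by simp
  ultimately show ?thesis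
    using grassmann_matrix_vee[of \<alpha> D] assms(2,3,7,9) by (intro ext) (simp del: dim_UNIV)
qed

end
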